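(* Let $G=(V(G),A(G))$ be a weakly connected digraph with $\delta^+(G)\geq 2$ and $\delta^-(G)\geq 1$. Let $\delta=\max\{\delta^+(G),\delta^-(G)\}$ and $\Delta=\min\{\Delta^+(G),\Delta^-(G)\}$. For every integer $n\geq 1$, $$(\delta-1)\,\delta^{n-1}\,|V(G)|\ \leq\ Z(L^n(G))\ \leq\ (\Delta-1)\,\Delta^{n-1}\,|V(G)|.$$
   Context: A digraph $G$ has a finite non-empty vertex set $V(G)$ and a set $A(G)\subseteq V(G)\times V(G)$ of arcs; loops $(u,u)$ are allowed. $N^+_G(v)=\{u:(v,u)\in A(G)\}$, $N^-_G(v)=\{w:(w,v)\in A(G)\}$, $d^\pm_G(v)=|N^\pm_G(v)|$; $\delta^\pm(G)$ and $\Delta^\pm(G)$ are the minimum and maximum of $d^\pm_G(v)$ over $v\in V(G)$. $G$ is weakly connected if its underlying undirected graph is connected. Line digraph: $L(G)$ has vertex set $\{uv:(u,v)\in A(G)\}$, with an arc from $uv$ to $xy$ exactly when $v=x$. $L^0(G)=G$ and $L^r(G)=L(L^{r-1}(G))$ for $r\geq 1$. Zero forcing in a digraph $H$: for non-empty $S\subseteq V(H)$ put $B^0(S)=S$ and, for $i\ge 0$: if $H$ has no loops, $B^{i+1}(S)=B^i(S)\cup\{v\in V(H)\setminus B^i(S):\exists u\in B^i(S),\ N^+_H(u)\setminus B^i(S)=\{v\}\}$; if $H$ has at least one loop, $B^{i+1}(S)=B^i(S)\cup\{v\in V(H)\setminus B^i(S):\exists u\in V(H),\ N^+_H(u)\setminus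 B^i(S)=\{v\}\}$. $S$ is a zero forcing set if $B^m(S)=V(H)$ for some $m\ge 0$. $Z(H)$ is the minimum cardinality of a zero forcing set of $H$. *)

theory Defs
  imports "Graph_Theory.Graph_Theory"
begin

text \<open>
  Digraphs are finite pair digraphs (\<^locale>\<open>pair_fin_digraph\<close>): loops are allowed and there are
  no parallel arcs, so \<^const>\<open>out_degree\<close> and \<^const>\<open>in_degree\<close>, which count arcs, agree with
  the numbers of out- and in-neighbours (a loop contributing one to each).
\<close>

definition out_nbrs :: "'a pair_pre_digraph \<Rightarrow> 'a \<Rightarrow> 'a set" where
  "out_nbrs H u = {v. (u, v) \<in> parcs H}"

definition min_out_degree :: "'a pair_pre_digraph \<Rightarrow> nat" where
  "min_out_degree G = Min (out_degree (with_proj G) ` pverts G)"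

definition max_out_degree :: "'a pair_pre_digraph \<Rightarrow> nat" where
  "max_out_degree G = Max (out_degree (with_proj G) ` pverts G)"

definition min_in_degree :: "'a pair_pre_digraph \<Rightarrow> nat" where
  "min_in_degree G = Min (in_degree (with_proj G) ` pverts G)"

definition max_in_degree :: "'a pair_pre_digraph \<Rightarrow> nat" where
  "max_in_degree G = Max (in_degree (with_proj G) ` pverts G)"

text \<open>
  The vertices of a line digraph are the arcs of the original one, so the vertex type would change
  with every iteration. The following type is closed under forming pairs: \<open>Arc u v\<close> is the
  arc from \<open>u\<close> to \<open>v\<close>, regarded as a vertex. The zeroth iterate is \<open>G\<close> with its vertices
  relabelled along the injection \<open>Vertex\<close>.
\<close>

datatype 'a line_vertex = Vertex 'a | Arc "'a line_vertex" "'a line_vertex"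

definition line_digraph ::
  "'a line_vertex pair_pre_digraph \<Rightarrow> 'a line_vertex pair_pre_digraph" where
  "line_digraph H =
    \<lparr> pverts = {Arc u v | u v. (u, v) \<in> parcs H},
      parcs = {(Arc u v, Arc x y) | u v x y. (u, v) \<in> parcs H \<and> (x, y) \<in> parcs H \<and> v = x} \<rparr>"

primrec iterated_line_digraph ::
  "nat \<Rightarrow> 'a pair_pre_digraph \<Rightarrow> 'a line_vertex pair_pre_digraph" where
  "iterated_line_digraph 0 G =
    \<lparr> pverts = Vertex ` pverts G, parcs = {(Vertex u, Vertex v) | u v. (u, v) \<in> parcs G} \<rparr>"
| "iterated_line_digraph (Suc r) G = line_digraph (iterated_line_digraph r G)"

definition has_loop :: "'a pair_pre_digraph \<Rightarrow> bool" where
  "has_loop H \<longleftrightarrow> (\<exists>u. (u, u) \<in> parcs H)"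

primrec forced :: "'a pair_pre_digraph \<Rightarrow> 'a set \<Rightarrow> nat \<Rightarrow> 'a set" where
  "forced H S 0 = S"
| "forced H S (Suc i) = forced H S i \<union>
    {v \<in> pverts H - forced H S i.
      \<exists>u \<in> (if has_loop H then pverts H else forced H S i).
        out_nbrs H u - forced H S i = {v}}"

definition zero_forcing_set :: "'a pair_pre_digraph \<Rightarrow> 'a set \<Rightarrow> bool" where
  "zero_forcing_set H S \<longleftrightarrow>
    S \<noteq> {} \<and> S \<subseteq> pverts H \<and> (\<exists>m. forced H S m = pverts H)"

definition zero_forcing_number :: "'a pair_pre_digraph \<Rightarrow> nat" where
  "zero_forcing_number H = Min (card ` {S. zero_forcing_set H S})"

end

theory Submission
  imports Defs
begin

text \<open>
  The out-neighbourhood of the vertex \<open>Arc u v\<close> of a line digraph depends on \<open>v\<close> only: it is the set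
  of arcs with tail \<open>v\<close>. These \<^emph>\<open>fans\<close> partition the vertices of the line digraph, and under the
  degree hypotheses they are exactly its out-neighbourhoods. Everything follows from the identity
  \<open>Z(L(H)) = |A(H)| - |V(H)|\<close>, valid whenever all out-degrees of \<open>H\<close> are at least two and all in-degrees are positive.

  Two white arcs of one fan block each other for ever, since whichever arc tries to force one of
  them sees the other as well. Hence a zero forcing set omits at most one arc of each fan, which
  gives \<open>\<ge>\<close> (\<open>zero_forcing_set_line_digraph_card_ge\<close>). Conversely, omit from each fan exactly one
  arc, from \<open>v\<close> to \<open>f v\<close>. The fan of \<open>v\<close> is completed as soon as some arc into \<open>v\<close> is black,
  and an arc into \<open>v\<close> is white only if it is the arc from some \<open>u\<close> to \<open>f u = v\<close> and the fan of
  \<open>u\<close> is still incomplete. The process can therefore get stuck only along directed cycles that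
  \<open>f\<close> follows and that no arc enters from outside. As out-degrees are at least two, every such
  cycle can be broken by redirecting \<open>f\<close> at one of its vertices, and a choice \<open>f\<close> that leaves as
  few vertices stuck as possible leaves none (\<open>exists_unlocking_choice\<close>). Loops only enlarge the
  set of vertices that may force, so the same set works with and without them.

  Finally, taking line digraphs preserves bounds on the in- and out-degrees, and
  \<open>|V(L(H))| = |A(H)|\<close> lies between \<open>\<delta> |V(H)|\<close> and \<open>\<Delta> |V(H)|\<close>; iterating this in
  \<open>Z(L\<^sup>n(G)) = |A(L\<^sup>n\<^sup>-\<^sup>1(G))| - |V(L\<^sup>n\<^sup>-\<^sup>1(G))|\<close> yields both bounds.
\<close>

section \<open>Counting arcs by their ends\<close>

definition in_nbrs :: "'a pair_pre_digraph \<Rightarrow> 'a \<Rightarrow> 'a set" where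
  "in_nbrs H v = {u. (u, v) \<in> parcs H}"

lemma out_degree_eq_card_out_nbrs: "out_degree (with_proj H) v = card (out_nbrs H v)"
proof -
  have "out_arcs (with_proj H) v = Pair v ` out_nbrs H v"
    by (auto simp: out_arcs_def out_nbrs_def)
  then show ?thesis by (simp add: out_degree_def card_image inj_on_def)
qed

lemma in_degree_eq_card_in_nbrs: "in_degree (with_proj H) v = card (in_nbrs H v)"
proof -
  have "in_arcs (with_proj H) v = (\<lambda>u. (u, v)) ` in_nbrs H v"
    by (auto simp: in_arcs_def in_nbrs_def)
  then show ?thesis by (simp add: in_degree_def card_image inj_on_def)
qed

context pair_fin_digraph
begin

lemma finite_out_nbrs: "finite (out_nbrs G v)"
  by (rule finite_subset[OF _ pair_finite_verts]) (auto simp: out_nbrs_def in_arcsD2)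

lemma finite_in_nbrs: "finite (in_nbrs G v)"
  by (rule finite_subset[OF _ pair_finite_verts]) (auto simp: in_nbrs_def in_arcsD1)

lemma card_parcs_eq_sum_out: "card (parcs G) = (\<Sum>v\<in>pverts G. card (out_nbrs G v))"
proof -
  have "parcs G = Sigma (pverts G) (out_nbrs G)"
    by (auto simp: out_nbrs_def in_arcsD1)
  then show ?thesis by (simp add: finite_out_nbrs pair_finite_verts)
qed

lemma card_parcs_eq_sum_in: "card (parcs G) = (\<Sum>v\<in>pverts G. card (in_nbrs G v))"
proof -
  have "parcs G = prod.swap ` Sigma (pverts G) (in_nbrs G)"
    by (auto simp: in_nbrs_def in_arcsD2 image_iff)
  then have "card (parcs G) = card (Sigma (pverts G) (in_nbrs G))"
    by (simp add: card_image)
  then show ?thesis by (simp add: finite_in_nbrs pair_finite_verts)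
qed

end

section \<open>Choosing the omitted arcs\<close>

text \<open>
  If only the arcs from \<open>u\<close> to \<open>f u\<close> are white at the start, the unlocked vertices are those that
  eventually receive a black arc, so that their fan can be completed.
\<close>

inductive unlocked :: "('a \<times> 'a) set \<Rightarrow> ('a \<Rightarrow> 'a) \<Rightarrow> 'a \<Rightarrow> bool" for A f where
  unchosen: "(u, v) \<in> A \<Longrightarrow> f u \<noteq> v \<Longrightarrow> unlocked A f v"
| propagate: "(u, v) \<in> A \<Longrightarrow> unlocked A f u \<Longrightarrow> unlocked A f v"

context pair_fin_digraph
begin

text \<open>
  On the set \<open>W\<close> of locked vertices \<open>f\<close> is a permutation: every vertex has an in-neighbour, every arc into a locked vertex comes from a
  locked vertex and is chosen by \<open>f\<close>, so \<open>W \<subseteq> f ` W\<close>, and \<open>W\<close> is finite. Redirecting \<open>f\<close>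
  at \<open>u \<in> W\<close> away from \<open>w = f u\<close> unlocks \<open>w\<close>, then the whole \<open>f\<close>-cycle of \<open>w\<close>, and with it
  \<open>u\<close> itself; so every vertex unlocked by means of the newly chosen arc remains unlocked.
\<close>

lemma unlock_more:
  assumes out2: "\<And>v. v \<in> pverts G \<Longrightarrow> card (out_nbrs G v) \<ge> 2"
    and in1: "\<And>v. v \<in> pverts G \<Longrightarrow> in_nbrs G v \<noteq> {}"
    and f: "\<And>v. v \<in> pverts G \<Longrightarrow> (v, f v) \<in> parcs G"
    and w: "w \<in> pverts G" "\<not> unlocked (parcs G) f w"
  shows "\<exists>f'. (\<forall>v\<in>pverts G. (v, f' v) \<in> parcs G) \<and>
    {v \<in> pverts G. unlocked (parcs G) f v} \<subset> {v \<in> pverts G. unlocked (parcs G) f' v}"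
proof -
  let ?A = "parcs G"
  define W where "W = {v \<in> pverts G. \<not> unlocked ?A f v}"
  have finW: "finite W" by (simp add: W_def pair_finite_verts)
  have pred: "u \<in> W \<and> f u = v" if "v \<in> W" "(u, v) \<in> ?A" for u v
  proof -
    have "\<not> unlocked ?A f u" "f u = v"
      using that unlocked.intros[of u v ?A f] by (auto simp: W_def)
    then show ?thesis using that by (simp add: W_def in_arcsD1)
  qed
  have sub: "W \<subseteq> f ` W"
  proof
    fix v assume v: "v \<in> W"
    then obtain u where "(u, v) \<in> ?A" using in1 by (auto simp: W_def in_nbrs_def)
    then show "v \<in> f ` W" using pred[OF v] by force
  qed
  have fW: "f ` W = W"
    using finW sub by (metis card_image_le card_seteq finite_imageI)
  have inj: "inj_on f W" using fW finW by (simp add: eq_card_imp_inj_on)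
  obtain u where u: "u \<in> W" "f u = w"
    using sub w by (force simp: W_def)
  \<comment> \<open>Redirect \<open>f\<close> at the predecessor \<open>u\<close> of \<open>w\<close> on its cycle.\<close>
  have uw: "(u, w) \<in> ?A" using u f by (force simp: W_def)
  have "out_nbrs G u \<noteq> {w}" using out2[of u] u by (auto simp: W_def)
  then obtain x where x: "(u, x) \<in> ?A" "x \<noteq> w" using uw by (auto simp: out_nbrs_def)
  define f' where "f' = f(u := x)"
  have f': "\<forall>v\<in>pverts G. (v, f' v) \<in> ?A" using f x by (simp add: f'_def)
  have w': "unlocked ?A f' w"
    using uw x by (simp add: f'_def unlocked.unchosen)
  \<comment> \<open>Unlocking spreads from \<open>w\<close> along \<open>f\<close>; the locked vertices it reaches form a finite set
    that \<open>f\<close> permutes, so it comes round to \<open>u\<close>.\<close>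
  define T where "T = {v \<in> W. unlocked ?A f' v}"
  have "f ` T \<subseteq> T"
  proof
    fix y assume "y \<in> f ` T"
    then obtain t where t: "t \<in> T" "y = f t" by auto
    have "(t, y) \<in> ?A" using t f by (auto simp: T_def W_def)
    then have "unlocked ?A f' y" using t by (auto simp: T_def dest: unlocked.propagate)
    then show "y \<in> T" using t fW by (auto simp: T_def)
  qed
  moreover have "inj_on f T" using inj by (rule inj_on_subset) (auto simp: T_def)
  moreover have "finite T" using finW by (simp add: T_def)
  ultimately have "f ` T = T" by (simp add: endo_inj_surj)
  moreover have "w \<in> T" using w w' by (simp add: T_def W_def)
  ultimately obtain t where "t \<in> T" "f t = w" by (metis imageE)
  then have u': "unlocked ?A f' u"
    using inj u by (auto simp: T_def dest: inj_onD)
  have mono: "unlocked ?A f' v" if "unlocked ?A f v" for v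
    using that
  proof induction
    case (unchosen t v)
    show ?case
    proof (cases "t = u")
      case True
      then show ?thesis using unchosen(1) u' by (simp add: unlocked.propagate)
    next
      case False
      then show ?thesis using unchosen by (simp add: f'_def unlocked.unchosen)
    qed
  next
    case (propagate t v)
    show ?case using propagate(1,3) by (rule unlocked.propagate)
  qed
  have "{v \<in> pverts G. unlocked ?A f v} \<subset> {v \<in> pverts G. unlocked ?A f' v}"
    using mono w w' by blast
  with f' show ?thesis by blast
qed

text \<open>Any choice with the largest number of unlocked vertices will do.\<close>

lemma exists_unlocking_choice:
  assumes out2: "\<And>v. v \<in> pverts G \<Longrightarrow> card (out_nbrs G v) \<ge> 2"
    and in1: "\<And>v. v \<in> pverts G \<Longrightarrow> in_nbrs G v \<noteq> {}"
  obtains f where "\<And>v. v \<in> pverts G \<Longrightarrow> (v, f v) \<in> parcs G"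
    and "\<And>v. v \<in> pverts G \<Longrightarrow> unlocked (parcs G) f v"
proof -
  let ?P = "\<lambda>f. \<forall>v\<in>pverts G. (v, f v) \<in> parcs G"
  let ?U = "\<lambda>f. {v \<in> pverts G. unlocked (parcs G) f v}"
  have "\<forall>v\<in>pverts G. \<exists>x. (v, x) \<in> parcs G"
  proof
    fix v assume "v \<in> pverts G"
    then have "out_nbrs G v \<noteq> {}" using out2[of v] by auto
    then show "\<exists>x. (v, x) \<in> parcs G" by (auto simp: out_nbrs_def)
  qed
  then obtain f0 where "?P f0" by metis
  moreover have "\<forall>f. ?P f \<longrightarrow> card (?U f) < Suc (card (pverts G))"
    by (auto simp: less_Suc_eq_le intro: card_mono pair_finite_verts)
  ultimately obtain f where f: "?P f" and max: "\<forall>g. ?P g \<longrightarrow> card (?U g) \<le> card (?U f)"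
    using ex_has_greatest_nat[of ?P f0 "\<lambda>f. card (?U f)"] by blast
  have "unlocked (parcs G) f v" if "v \<in> pverts G" for v
  proof (rule ccontr)
    assume locked: "\<not> unlocked (parcs G) f v"
    have "\<exists>g. ?P g \<and> ?U f \<subset> ?U g"
      by (rule unlock_more[OF _ _ _ that locked]) (use out2 in1 f in blast)+
    then obtain g where "?P g" "?U f \<subset> ?U g" by blast
    then show False
      using max psubset_card_mono[of "?U g" "?U f"] pair_finite_verts by fastforce
  qed
  then show thesis using that f by blast
qed

end

section \<open>Line digraphs\<close>

lemma pverts_line_digraph: "pverts (line_digraph H) = case_prod Arc ` parcs H"
  by (auto simp: line_digraph_def)

lemma card_pverts_line_digraph: "card (pverts (line_digraph H)) = card (parcs H)"
  unfolding pverts_line_digraph by (rule card_image) (auto simp: inj_on_def)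

lemma Arc_in_out_nbrs_line_digraph:
  "Arc v x \<in> out_nbrs (line_digraph H) e \<longleftrightarrow>
    (v, x) \<in> parcs H \<and> (\<exists>u. (u, v) \<in> parcs H \<and> e = Arc u v)"
  by (auto simp: line_digraph_def out_nbrs_def)

lemma out_nbrs_line_digraph:
  "(u, v) \<in> parcs H \<Longrightarrow> out_nbrs (line_digraph H) (Arc u v) = Arc v ` out_nbrs H v"
  by (auto simp: line_digraph_def out_nbrs_def)

lemma in_nbrs_line_digraph:
  "(u, v) \<in> parcs H \<Longrightarrow> in_nbrs (line_digraph H) (Arc u v) = (\<lambda>t. Arc t u) ` in_nbrs H u"
  by (auto simp: line_digraph_def in_nbrs_def)

lemma pair_fin_digraph_line_digraph:
  assumes "pair_fin_digraph H"
  shows "pair_fin_digraph (line_digraph H)"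
proof -
  interpret H: pair_fin_digraph H by fact
  have fin: "finite (pverts (line_digraph H))"
    by (simp add: pverts_line_digraph H.pair_finite_arcs)
  have sub: "parcs (line_digraph H) \<subseteq> pverts (line_digraph H) \<times> pverts (line_digraph H)"
    by (auto simp: line_digraph_def)
  show ?thesis
  proof
    show "finite (parcs (line_digraph H))"
      using finite_subset[OF sub] fin by simp
  qed (use fin sub in auto)
qed

section \<open>Zero forcing in line digraphs\<close>

lemma forced_subset_pverts: "S \<subseteq> pverts H \<Longrightarrow> forced H S i \<subseteq> pverts H"
  by (induction i) auto

lemma subset_forced: "S \<subseteq> forced H S i"
  by (induction i) auto

lemma forced_stabilises:
  assumes "finite (pverts H)" "S \<subseteq> pverts H"
  obtains m where "forced H S (Suc m) = forced H S m"
proof -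
  have "\<exists>m. forced H S (Suc m) = forced H S m"
  proof (rule ccontr)
    assume no: "\<not> ?thesis"
    have fin: "finite (forced H S i)" for i
      using assms forced_subset_pverts finite_subset by metis
    have grow: "forced H S i \<subset> forced H S (Suc i)" for i
    proof
      show "forced H S i \<subseteq> forced H S (Suc i)" by simp
      show "forced H S i \<noteq> forced H S (Suc i)" using no by metis
    qed
    have "i \<le> card (forced H S i)" for i
    proof (induction i)
      case (Suc i)
      then show ?case using psubset_card_mono[OF fin grow[of i]] by linarith
    qed simp
    then have "Suc (card (pverts H)) \<le> card (pverts H)"
      using card_mono[OF assms(1) forced_subset_pverts[OF assms(2)]] le_trans by blast
    then show False by simp
  qed
  then show thesis using that by blast
qed

text \<open>
  Whatever sees one arc of a fan as an out-neighbour sees the whole fan. While both \<open>Arc v x\<close> and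
  \<open>Arc v y\<close> are white, nothing can therefore see exactly one of them as its only white
  out-neighbour.
\<close>

lemma forced_line_digraph_blocked:
  assumes "x \<noteq> y" "(v, x) \<in> parcs H" "(v, y) \<in> parcs H" "S \<subseteq> pverts (line_digraph H)"
    and "Arc v x \<notin> S" "Arc v y \<notin> S"
  shows "Arc v x \<notin> forced (line_digraph H) S i \<and> Arc v y \<notin> forced (line_digraph H) S i"
proof (induction i)
  case 0
  then show ?case using assms by simp
next
  case (Suc i)
  let ?F = "forced (line_digraph H) S i"
  have both: "Arc v x \<in> out_nbrs (line_digraph H) e \<and> Arc v y \<in> out_nbrs (line_digraph H) e"
    if "Arc v x \<in> out_nbrs (line_digraph H) e \<or> Arc v y \<in> out_nbrs (line_digraph H) e" for e
    using that assms(2,3) by (simp add: Arc_in_out_nbrs_line_digraph)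
  have "out_nbrs (line_digraph H) e - ?F \<noteq> {Arc v z}" if "z = x \<or> z = y" for e z
  proof
    assume eq: "out_nbrs (line_digraph H) e - ?F = {Arc v z}"
    then have "Arc v x \<in> out_nbrs (line_digraph H) e - ?F"
      "Arc v y \<in> out_nbrs (line_digraph H) e - ?F"
      using both[of e] Suc that by blast+
    then show False using eq assms(1) by simp
  qed
  then show ?case using Suc by simp
qed

lemma zero_forcing_set_line_digraph_card_ge:
  assumes "pair_fin_digraph H" "zero_forcing_set (line_digraph H) S"
  shows "card (parcs H) \<le> card S + card (pverts H)"
proof -
  interpret H: pair_fin_digraph H by fact
  have S: "S \<subseteq> pverts (line_digraph H)"
    and ex: "\<exists>m. forced (line_digraph H) S m = pverts (line_digraph H)"
    using assms(2) by (auto simp: zero_forcing_set_def)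
  have fin: "finite (pverts (line_digraph H))"
    by (simp add: pverts_line_digraph H.pair_finite_arcs)
  define R where "R = {(u, v) \<in> parcs H. Arc u v \<notin> S}"
  have "inj_on fst R"
  proof (rule inj_onI, clarsimp simp: R_def)
    fix v x y
    assume *: "(v, x) \<in> parcs H" "(v, y) \<in> parcs H" "Arc v x \<notin> S" "Arc v y \<notin> S"
    obtain m where "forced (line_digraph H) S m = pverts (line_digraph H)" using ex by blast
    then have "Arc v x \<in> forced (line_digraph H) S m"
      using * by (auto simp: pverts_line_digraph)
    then show "x = y" using forced_line_digraph_blocked[OF _ *(1,2) S *(3,4)] by blast
  qed
  moreover have "fst ` R \<subseteq> pverts H" by (auto simp: R_def H.in_arcsD1)
  ultimately have "card R \<le> card (pverts H)"
    using H.pair_finite_verts by (rule card_inj_on_le)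
  moreover have "pverts (line_digraph H) = S \<union> case_prod Arc ` R"
    using S by (auto simp: pverts_line_digraph R_def)
  then have "card (parcs H) \<le> card S + card (case_prod Arc ` R)"
    by (metis card_Un_le card_pverts_line_digraph)
  moreover have "card (case_prod Arc ` R) \<le> card R"
    by (rule card_image_le) (auto simp: R_def intro: finite_subset[OF _ H.pair_finite_arcs])
  ultimately show ?thesis by linarith
qed

text \<open>
  At a fixed point \<open>F\<close> of the process nothing more is forced, so a fan with at most one white
  arc lies in \<open>F\<close> as soon as \<open>F\<close> contains an arc into its common tail. Only black arcs are
  used as forcing vertices here, which both versions of the forcing rule permit.
\<close>

lemma zero_forcing_set_omitting_unlocking_choice:
  assumes "pair_fin_digraph H"
    and f: "\<And>v. v \<in> pverts H \<Longrightarrow> (v, f v) \<in> parcs H"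
    and unlocked: "\<And>v. v \<in> pverts H \<Longrightarrow> unlocked (parcs H) f v"
    and S: "S = {Arc u v | u v. (u, v) \<in> parcs H \<and> f u \<noteq> v}" "S \<noteq> {}"
  shows "zero_forcing_set (line_digraph H) S"
proof -
  interpret H: pair_fin_digraph H by fact
  let ?L = "line_digraph H"
  have sub: "S \<subseteq> pverts ?L" by (auto simp: S pverts_line_digraph)
  obtain m where m: "forced ?L S (Suc m) = forced ?L S m"
    using forced_stabilises[OF _ sub] by (auto simp: pverts_line_digraph H.pair_finite_arcs)
  define F where "F = forced ?L S m"
  have SF: "S \<subseteq> F" by (simp add: F_def subset_forced)
  have FV: "F \<subseteq> pverts ?L" by (simp add: F_def forced_subset_pverts sub)
  have no_force: "out_nbrs ?L e - F \<noteq> {a}" if "e \<in> F" "a \<in> pverts ?L" for e a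
  proof
    assume eq: "out_nbrs ?L e - F = {a}"
    have "e \<in> pverts ?L" using that FV by auto
    with that eq have "a \<in> forced ?L S (Suc m)" by (auto simp: F_def)
    then show False using m eq by (auto simp: F_def)
  qed
  have fan: "Arc v x \<in> F" if e: "Arc t v \<in> F" and vx: "(v, x) \<in> parcs H" for t v x
  proof (rule ccontr)
    assume out: "Arc v x \<notin> F"
    have tv: "(t, v) \<in> parcs H" using e FV by (auto simp: pverts_line_digraph)
    \<comment> \<open>The chosen arc is the only one of the fan that can be white.\<close>
    have "f v = z" if "(v, z) \<in> parcs H" "Arc v z \<notin> F" for z
      using that SF by (auto simp: S)
    then have "out_nbrs ?L (Arc t v) - F = {Arc v x}"
      unfolding out_nbrs_line_digraph[OF tv] using out vx by (auto simp: out_nbrs_def)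
    then show False using no_force[OF e] vx by (auto simp: pverts_line_digraph)
  qed
  have "\<forall>x. (v, x) \<in> parcs H \<longrightarrow> Arc v x \<in> F" if "unlocked (parcs H) f v" for v
    using that
  proof induction
    case (unchosen u v)
    then have "Arc u v \<in> F" using SF by (auto simp: S)
    then show ?case using fan by blast
  next
    case (propagate u v)
    then show ?case using fan by blast
  qed
  then have "pverts ?L \<subseteq> F" using unlocked by (auto simp: pverts_line_digraph H.in_arcsD1)
  then have "forced ?L S m = pverts ?L" using FV by (auto simp: F_def)
  then show ?thesis using S(2) sub by (auto simp: zero_forcing_set_def)
qed

theorem zero_forcing_number_line_digraph:
  assumes "pair_fin_digraph H" "pverts H \<noteq> {}"
    and out2: "\<And>v. v \<in> pverts H \<Longrightarrow> card (out_nbrs H v) \<ge> 2"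
    and in1: "\<And>v. v \<in> pverts H \<Longrightarrow> card (in_nbrs H v) \<ge> 1"
  shows "zero_forcing_number (line_digraph H) + card (pverts H) = card (parcs H)"
proof -
  interpret H: pair_fin_digraph H by fact
  let ?L = "line_digraph H"
  have "in_nbrs H v \<noteq> {}" if "v \<in> pverts H" for v using in1[OF that] by auto
  then obtain f where f: "\<And>v. v \<in> pverts H \<Longrightarrow> (v, f v) \<in> parcs H"
    and unl: "\<And>v. v \<in> pverts H \<Longrightarrow> unlocked (parcs H) f v"
    using H.exists_unlocking_choice[OF out2] by blast
  define B where "B = (\<lambda>v. (v, f v)) ` pverts H"
  have B: "B \<subseteq> parcs H" "card B = card (pverts H)"
    using f by (auto simp: B_def card_image inj_on_def)
  define S where "S = {Arc u v | u v. (u, v) \<in> parcs H \<and> f u \<noteq> v}"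
  have S_eq: "S = case_prod Arc ` (parcs H - B)"
    by (auto simp: S_def B_def H.in_arcsD1)
  have "card S = card (parcs H - B)"
    unfolding S_eq by (rule card_image) (auto simp: inj_on_def)
  also have "\<dots> = card (parcs H) - card (pverts H)"
    using B by (simp add: card_Diff_subset finite_subset[OF _ H.pair_finite_arcs])
  finally have cardS: "card S = card (parcs H) - card (pverts H)" .
  have "2 * card (pverts H) \<le> card (parcs H)"
    using sum_mono[of "pverts H" "\<lambda>_. 2" "\<lambda>v. card (out_nbrs H v)"] out2
    by (simp add: H.card_parcs_eq_sum_out mult.commute)
  moreover have "card (pverts H) > 0"
    using assms(2) H.pair_finite_verts by (simp add: card_gt_0_iff)
  ultimately have less: "card (pverts H) < card (parcs H)" by linarith
  then have "S \<noteq> {}" using cardS by auto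
  then have zf: "zero_forcing_set ?L S"
    using zero_forcing_set_omitting_unlocking_choice[OF assms(1) f unl S_def] by blast
  have "{T. zero_forcing_set ?L T} \<subseteq> Pow (pverts ?L)"
    by (auto simp: zero_forcing_set_def)
  then have "finite {T. zero_forcing_set ?L T}"
    by (rule finite_subset) (simp add: pverts_line_digraph H.pair_finite_arcs)
  moreover have "card S \<le> card T" if "zero_forcing_set ?L T" for T
    using zero_forcing_set_line_digraph_card_ge[OF assms(1) that] cardS by linarith
  ultimately have "zero_forcing_number ?L = card S"
    unfolding zero_forcing_number_def using zf by (intro Min_eqI) auto
  then show ?thesis using cardS less by linarith
qed

section \<open>Iterated line digraphs\<close>

lemma pair_fin_digraph_iterated_line_digraph:
  assumes "pair_fin_digraph G"
  shows "pair_fin_digraph (iterated_line_digraph n G)"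
proof (induction n)
  case 0
  interpret G: pair_fin_digraph G by fact
  have "parcs (iterated_line_digraph 0 G) = map_prod Vertex Vertex ` parcs G" by auto
  then show ?case
    by unfold_locales
      (auto simp: G.pair_finite_verts G.pair_finite_arcs G.in_arcsD1 G.in_arcsD2)
next
  case (Suc n)
  then show ?case by (simp add: pair_fin_digraph_line_digraph)
qed

lemma pverts_line_digraph_degrees:
  assumes "pair_fin_digraph H" "e \<in> pverts (line_digraph H)"
  obtains u v where "u \<in> pverts H" "v \<in> pverts H"
    "card (out_nbrs (line_digraph H) e) = card (out_nbrs H v)"
    "card (in_nbrs (line_digraph H) e) = card (in_nbrs H u)"
proof -
  interpret H: pair_fin_digraph H by fact
  obtain u v where "(u, v) \<in> parcs H" "e = Arc u v"
    using assms(2) by (auto simp: pverts_line_digraph)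
  then show thesis
    using that[of u v]
    by (simp add: out_nbrs_line_digraph in_nbrs_line_digraph card_image inj_on_def
        H.in_arcsD1 H.in_arcsD2)
qed

text \<open>
  Passing to the line digraph produces no new degrees, so every bound on the degrees of \<open>G\<close> holds
  for all iterates.
\<close>

lemma iterated_line_digraph_degrees:
  assumes "pair_fin_digraph G"
  shows "e \<in> pverts (iterated_line_digraph n G) \<Longrightarrow>
    \<exists>u\<in>pverts G. \<exists>v\<in>pverts G.
      card (out_nbrs (iterated_line_digraph n G) e) = card (out_nbrs G v) \<and>
      card (in_nbrs (iterated_line_digraph n G) e) = card (in_nbrs G u)"
proof (induction n arbitrary: e)
  case 0
  then obtain v where v: "v \<in> pverts G" "e = Vertex v" by auto
  then have "out_nbrs (iterated_line_digraph 0 G) e = Vertex ` out_nbrs G v"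
    "in_nbrs (iterated_line_digraph 0 G) e = Vertex ` in_nbrs G v"
    by (auto simp: out_nbrs_def in_nbrs_def)
  then show ?case using v by (auto simp: card_image inj_on_def)
next
  case (Suc n)
  then show ?case
    using pverts_line_digraph_degrees[OF pair_fin_digraph_iterated_line_digraph[OF assms, of n]]
    by (metis iterated_line_digraph.simps(2))
qed

lemma (in pair_fin_digraph) card_parcs_bounds:
  assumes "\<And>v. v \<in> pverts G \<Longrightarrow> a \<le> card (out_nbrs G v) \<and> card (out_nbrs G v) \<le> b"
    and "\<And>v. v \<in> pverts G \<Longrightarrow> c \<le> card (in_nbrs G v) \<and> card (in_nbrs G v) \<le> d"
  shows "max a c * card (pverts G) \<le> card (parcs G)"
    and "card (parcs G) \<le> min b d * card (pverts G)"
proof -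
  let ?o = "\<lambda>v. card (out_nbrs G v)" and ?i = "\<lambda>v. card (in_nbrs G v)" and ?V = "pverts G"
  have "a * card ?V \<le> card (parcs G)" "card (parcs G) \<le> b * card ?V"
    using sum_mono[of ?V "\<lambda>_. a" ?o] sum_mono[of ?V ?o "\<lambda>_. b"] assms(1)
    by (auto simp: card_parcs_eq_sum_out mult.commute)
  moreover have "c * card ?V \<le> card (parcs G)" "card (parcs G) \<le> d * card ?V"
    using sum_mono[of ?V "\<lambda>_. c" ?i] sum_mono[of ?V ?i "\<lambda>_. d"] assms(2)
    by (auto simp: card_parcs_eq_sum_in mult.commute)
  ultimately show "max a c * card ?V \<le> card (parcs G)" "card (parcs G) \<le> min b d * card ?V"
    by (auto simp: max_def min_def)
qed

theorem corollary3p14: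
  fixes G :: "'a pair_pre_digraph" and \<delta> \<Delta> n :: nat
  assumes "pair_fin_digraph G"
    and "pverts G \<noteq> {}"
    and "Digraph_Component.connected (with_proj G)"
    and "min_out_degree G \<ge> 2"
    and "min_in_degree G \<ge> 1"
    and "\<delta> = max (min_out_degree G) (min_in_degree G)"
    and "\<Delta> = min (max_out_degree G) (max_in_degree G)"
    and "n \<ge> 1"
  shows "(int \<delta> - 1) * int \<delta> ^ (n - 1) * int (card (pverts G))
           \<le> int (zero_forcing_number (iterated_line_digraph n G))
       \<and> int (zero_forcing_number (iterated_line_digraph n G))
           \<le> (int \<Delta> - 1) * int \<Delta> ^ (n - 1) * int (card (pverts G))"
proof -
  interpret G: pair_fin_digraph G by fact
  let ?L = "\<lambda>k. iterated_line_digraph k G"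
  let ?v = "\<lambda>k. card (pverts (?L k))"
  have deg_out: "min_out_degree G \<le> card (out_nbrs G v) \<and> card (out_nbrs G v) \<le> max_out_degree G"
    if "v \<in> pverts G" for v
    using that G.pair_finite_verts
    by (simp add: min_out_degree_def max_out_degree_def out_degree_eq_card_out_nbrs)
  have deg_in: "min_in_degree G \<le> card (in_nbrs G v) \<and> card (in_nbrs G v) \<le> max_in_degree G"
    if "v \<in> pverts G" for v
    using that G.pair_finite_verts
    by (simp add: min_in_degree_def max_in_degree_def in_degree_eq_card_in_nbrs)
  have degs:
    "min_out_degree G \<le> card (out_nbrs (?L k) e) \<and> card (out_nbrs (?L k) e) \<le> max_out_degree G"
    "min_in_degree G \<le> card (in_nbrs (?L k) e) \<and> card (in_nbrs (?L k) e) \<le> max_in_degree G"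
    if "e \<in> pverts (?L k)" for k e
    using iterated_line_digraph_degrees[OF assms(1) that] deg_out deg_in by force+
  have fin: "pair_fin_digraph (?L k)" for k
    by (rule pair_fin_digraph_iterated_line_digraph[OF assms(1)])
  have arcs: "card (parcs (?L k)) = ?v (Suc k)" for k
    by (simp add: card_pverts_line_digraph)
  have step: "\<delta> * ?v k \<le> ?v (Suc k)" "?v (Suc k) \<le> \<Delta> * ?v k" for k
    using pair_fin_digraph.card_parcs_bounds[OF fin degs, of k] assms(6,7) by (auto simp: arcs)
  have v0: "card (Vertex ` pverts G) = card (pverts G)" by (simp add: card_image inj_on_def)
  have lower: "\<delta> ^ k * card (pverts G) \<le> ?v k" for k
  proof (induction k)
    case (Suc k)
    have "\<delta> ^ Suc k * card (pverts G) \<le> \<delta> * ?v k"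
      using mult_le_mono2[OF Suc, of \<delta>] by (simp add: mult.assoc)
    then show ?case using step(1)[of k] by linarith
  qed (simp add: v0)
  have upper: "?v k \<le> \<Delta> ^ k * card (pverts G)" for k
  proof (induction k)
    case (Suc k)
    have "\<Delta> * ?v k \<le> \<Delta> ^ Suc k * card (pverts G)"
      using mult_le_mono2[OF Suc, of \<Delta>] by (simp add: mult.assoc)
    then show ?case using step(2)[of k] by linarith
  qed (simp add: v0)
  obtain k where k: "n = Suc k" using assms(8) by (cases n) auto
  have \<delta>: "\<delta> \<ge> 2" using assms(4,6) by simp
  have pos: "?v k > 0"
  proof -
    have "0 < \<delta> ^ k * card (pverts G)"
      using \<delta> assms(2) G.pair_finite_verts by (simp add: card_gt_0_iff)
    then show ?thesis using lower[of k] by linarith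
  qed
  have \<Delta>: "\<Delta> \<ge> 1"
  proof -
    have "0 < \<Delta> * ?v k"
      using step[of k] \<delta> pos by (metis gr0I le_zero_eq mult_is_0 not_numeral_le_zero)
    then show ?thesis by (cases \<Delta>) auto
  qed
  have "zero_forcing_number (?L n) + ?v k = ?v (Suc k)"
  proof -
    have "pverts (?L k) \<noteq> {}" using pos by auto
    moreover have "card (out_nbrs (?L k) e) \<ge> 2" "card (in_nbrs (?L k) e) \<ge> 1"
      if "e \<in> pverts (?L k)" for e
      using degs[OF that] assms(4,5) by linarith+
    ultimately have "zero_forcing_number (line_digraph (?L k)) + ?v k = card (parcs (?L k))"
      using zero_forcing_number_line_digraph[OF fin] by blast
    then show ?thesis by (simp only: k arcs iterated_line_digraph.simps)
  qed
  then have Z: "int (zero_forcing_number (?L n)) = int (?v (Suc k)) - int (?v k)" by linarith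
  have "(int \<delta> - 1) * (int \<delta> ^ k * int (card (pverts G))) \<le> (int \<delta> - 1) * int (?v k)"
    using \<delta> lower[of k]
    by (intro mult_left_mono) (simp_all flip: of_nat_power of_nat_mult)
  also have "\<dots> \<le> int (?v (Suc k)) - int (?v k)"
    using step(1)[of k] by (simp add: left_diff_distrib flip: of_nat_mult)
  finally have L: "(int \<delta> - 1) * int \<delta> ^ k * int (card (pverts G)) \<le> int (zero_forcing_number (?L n))"
    using Z by (simp add: mult.assoc)
  have "int (?v (Suc k)) - int (?v k) \<le> (int \<Delta> - 1) * int (?v k)"
    using step(2)[of k] by (simp add: left_diff_distrib flip: of_nat_mult)
  also have "\<dots> \<le> (int \<Delta> - 1) * (int \<Delta> ^ k * int (card (pverts G)))"
    using \<Delta> upper[of k]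
    by (intro mult_left_mono) (simp_all flip: of_nat_power of_nat_mult)
  finally have U: "int (zero_forcing_number (?L n)) \<le> (int \<Delta> - 1) * int \<Delta> ^ k * int (card (pverts G))"
    using Z by (simp add: mult.assoc)
  show ?thesis using L U k by simp
qed

end
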